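(* Let $\mathscr{K}$ be an essentially small monoidal-triangulated category. Then the map $$T_s(\mathscr{K}) \longrightarrow \Omega(\mathrm{Spc}(\mathscr{K})^\nu),\qquad \mathscr{I}\longmapsto \bigcup_{x\in\mathscr{I}}\mathrm{supp}(x),$$ is a (natural) isomorphism of lattices (equivalently, of frames) from the lattice of semiprime thick $\otimes$-ideals of $\mathscr{K}$ to the lattice of open subsets of $\mathrm{Spc}(\mathscr{K})^\nu$. Here $\mathrm{Spc}(\mathscr{K})^\nu$ is the set $\mathrm{Spc}(\mathscr{K})$ of prime thick $\otimes$-ideals with the topology having the supports $\mathrm{supp}(x)$, $x\in\mathscr{K}$, as a base of open subsets.
   Context: A monoidal-triangulated category is a triangulated category $\mathscr{K}$ with a monoidal structure $(\otimes,\mathbb{1})$, not assumed symmetric or braided, such that $\otimes$ is exact in each variable. A thick subcategory is a full triangulated subcategory closed under direct summands; a thick $\otimes$-ideal is a thick subcategory $\mathscr{I}$ with $x\otimes y,\ y\otimes x\in\mathscr{I}$ for all $x\in\mathscr{I}$, $y\in\mathscr{K}$. A proper thick $\otimes$-ideal $\mathscr{P}$ is prime if for all thick $\otimes$-ideals $\mathscr{I},\mathscr{J}$, $\mathscr{I}\otimes\mathscr{J}\subseteq\mathscr{P}$ implies $\mathscr{I}\subseteq\mathscr{P}$ or $\mathscr{J}\subseteq\mathscr{P}$. A thick $\otimes$-ideal is semiprime if it is an intersection of prime thick $\otimes$-ideals ($\mathscr{K}$ being the empty intersection). $T_s(\mathscr{K})$ is the set of semiprime thick $\otimes$-ideals ordered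 by inclusion (a complete lattice, with meets given by intersections). $\mathrm{Spc}(\mathscr{K})$ is the set of prime thick $\otimes$-ideals, and $\mathrm{supp}(x)=\{\mathscr{P}\in\mathrm{Spc}(\mathscr{K})\mid x\notin\mathscr{P}\}$. $\Omega(X)$ is the lattice of open subsets of a topological space $X$. *)

theory Defs
  imports
    "HOL-Algebra.Complete_Lattice"
    "HOL-Algebra.Group"
    "HOL-Analysis.Abstract_Topology"
begin

section \<open>Categories and functors\<close>

text \<open>
  Objects and arrows form sets inside HOL types, so every category below is small by construction.
  An essentially small category is equivalent to such a category, and the type variables are
  arbitrary; no separate smallness hypothesis is needed. In \<open>g \<cdot> f\<close> the arrow
  \<open>f\<close> is applied first.
\<close>

record ('o, 'm) category =
  Ob :: "'o set"
  Ar :: "'m set"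
  Src :: "'m \<Rightarrow> 'o"
  Tgt :: "'m \<Rightarrow> 'o"
  Idn :: "'o \<Rightarrow> 'm"
  Cmp :: "'m \<Rightarrow> 'm \<Rightarrow> 'm" (infixr "\<cdot>\<index>" 70)

definition Hom :: "('o, 'm, 'a) category_scheme \<Rightarrow> 'o \<Rightarrow> 'o \<Rightarrow> 'm set" where
  "Hom C x y = {f \<in> Ar C. Src C f = x \<and> Tgt C f = y}"

locale category =
  fixes C :: "('o, 'm, 'a) category_scheme" (structure)
  assumes Src_closed: "f \<in> Ar C \<Longrightarrow> Src C f \<in> Ob C"
    and Tgt_closed: "f \<in> Ar C \<Longrightarrow> Tgt C f \<in> Ob C"
    and Idn_in_Hom: "x \<in> Ob C \<Longrightarrow> Idn C x \<in> Hom C x x"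
    and Cmp_in_Hom: "\<lbrakk>f \<in> Hom C x y; g \<in> Hom C y z\<rbrakk> \<Longrightarrow> g \<cdot> f \<in> Hom C x z"
    and Cmp_Idn: "f \<in> Hom C x y \<Longrightarrow> f \<cdot> Idn C x = f"
    and Idn_Cmp: "f \<in> Hom C x y \<Longrightarrow> Idn C y \<cdot> f = f"
    and Cmp_assoc: "\<lbrakk>f \<in> Hom C w x; g \<in> Hom C x y; h \<in> Hom C y z\<rbrakk> \<Longrightarrow>
          (h \<cdot> g) \<cdot> f = h \<cdot> (g \<cdot> f)"

definition isomorphisms :: "('o, 'm, 'a) category_scheme \<Rightarrow> 'o \<Rightarrow> 'o \<Rightarrow> 'm set" where
  "isomorphisms C x y = {f \<in> Hom C x y.
     \<exists>g \<in> Hom C y x. g \<cdot>\<^bsub>C\<^esub> f = Idn C x \<and> f \<cdot>\<^bsub>C\<^esub> g = Idn C y}"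

definition is_functor ::
  "('o, 'm, 'a) category_scheme \<Rightarrow> ('p, 'n, 'b) category_scheme \<Rightarrow>
   ('o \<Rightarrow> 'p) \<Rightarrow> ('m \<Rightarrow> 'n) \<Rightarrow> bool" where
  "is_functor C D FO FM \<longleftrightarrow>
     (\<forall>x \<in> Ob C. FO x \<in> Ob D \<and> FM (Idn C x) = Idn D (FO x)) \<and>
     (\<forall>x y. \<forall>f \<in> Hom C x y. FM f \<in> Hom D (FO x) (FO y)) \<and>
     (\<forall>x y z. \<forall>f \<in> Hom C x y. \<forall>g \<in> Hom C y z. FM (g \<cdot>\<^bsub>C\<^esub> f) = FM g \<cdot>\<^bsub>D\<^esub> FM f)"

definition is_natural_isomorphism ::
  "('o, 'm, 'a) category_scheme \<Rightarrow> ('p, 'n, 'b) category_scheme \<Rightarrow>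
   ('o \<Rightarrow> 'p) \<Rightarrow> ('m \<Rightarrow> 'n) \<Rightarrow> ('o \<Rightarrow> 'p) \<Rightarrow> ('m \<Rightarrow> 'n) \<Rightarrow> ('o \<Rightarrow> 'n) \<Rightarrow> bool" where
  "is_natural_isomorphism C D FO FM GO GM \<eta> \<longleftrightarrow>
     (\<forall>x \<in> Ob C. \<eta> x \<in> isomorphisms D (FO x) (GO x)) \<and>
     (\<forall>x y. \<forall>f \<in> Hom C x y. GM f \<cdot>\<^bsub>D\<^esub> \<eta> x = \<eta> y \<cdot>\<^bsub>D\<^esub> FM f)"

definition is_equivalence ::
  "('o, 'm, 'a) category_scheme \<Rightarrow> ('p, 'n, 'b) category_scheme \<Rightarrow>
   ('o \<Rightarrow> 'p) \<Rightarrow> ('m \<Rightarrow> 'n) \<Rightarrow> bool" where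
  "is_equivalence C D FO FM \<longleftrightarrow>
     is_functor C D FO FM \<and>
     (\<forall>x \<in> Ob C. \<forall>y \<in> Ob C. bij_betw FM (Hom C x y) (Hom D (FO x) (FO y))) \<and>
     (\<forall>d \<in> Ob D. \<exists>x \<in> Ob C. isomorphisms D (FO x) d \<noteq> {})"


section \<open>Additive categories\<close>

record ('o, 'm) additive_category = "('o, 'm) category" +
  Add :: "'m \<Rightarrow> 'm \<Rightarrow> 'm"
  Zer :: "'o \<Rightarrow> 'o \<Rightarrow> 'm"

definition hom_group ::
  "('o, 'm, 'a) additive_category_scheme \<Rightarrow> 'o \<Rightarrow> 'o \<Rightarrow> 'm monoid" where
  "hom_group C x y = \<lparr>carrier = Hom C x y, monoid.mult = Add C, one = Zer C x y\<rparr>"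

definition Neg :: "('o, 'm, 'a) additive_category_scheme \<Rightarrow> 'm \<Rightarrow> 'm" where
  "Neg C f = inv\<^bsub>hom_group C (Src C f) (Tgt C f)\<^esub> f"

definition zero_object :: "('o, 'm, 'a) category_scheme \<Rightarrow> 'o \<Rightarrow> bool" where
  "zero_object C z \<longleftrightarrow>
     z \<in> Ob C \<and> (\<forall>x \<in> Ob C. (\<exists>!f. f \<in> Hom C x z) \<and> (\<exists>!f. f \<in> Hom C z x))"

definition is_biproduct ::
  "('o, 'm, 'a) additive_category_scheme \<Rightarrow> 'o \<Rightarrow> 'o \<Rightarrow> 'o \<Rightarrow> bool" where
  "is_biproduct C x y s \<longleftrightarrow>
     x \<in> Ob C \<and> y \<in> Ob C \<and> s \<in> Ob C \<and>
     (\<exists>i \<in> Hom C x s. \<exists>j \<in> Hom C y s. \<exists>p \<in> Hom C s x. \<exists>q \<in> Hom C s y.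
        p \<cdot>\<^bsub>C\<^esub> i = Idn C x \<and> q \<cdot>\<^bsub>C\<^esub> j = Idn C y \<and>
        q \<cdot>\<^bsub>C\<^esub> i = Zer C x y \<and> p \<cdot>\<^bsub>C\<^esub> j = Zer C y x \<and>
        Add C (i \<cdot>\<^bsub>C\<^esub> p) (j \<cdot>\<^bsub>C\<^esub> q) = Idn C s)"

locale additive_category = category C
  for C :: "('o, 'm, 'a) additive_category_scheme" (structure) +
  assumes hom_comm_group: "\<lbrakk>x \<in> Ob C; y \<in> Ob C\<rbrakk> \<Longrightarrow> comm_group (hom_group C x y)"
    and Cmp_Add_left: "\<lbrakk>f \<in> Hom C x y; g \<in> Hom C y z; g' \<in> Hom C y z\<rbrakk> \<Longrightarrow>
          Add C g g' \<cdot> f = Add C (g \<cdot> f) (g' \<cdot> f)"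
    and Cmp_Add_right: "\<lbrakk>f \<in> Hom C x y; f' \<in> Hom C x y; g \<in> Hom C y z\<rbrakk> \<Longrightarrow>
          g \<cdot> Add C f f' = Add C (g \<cdot> f) (g \<cdot> f')"
    and ex_zero_object: "\<exists>z. zero_object C z"
    and ex_biproduct: "\<lbrakk>x \<in> Ob C; y \<in> Ob C\<rbrakk> \<Longrightarrow> \<exists>s. is_biproduct C x y s"

definition is_additive_functor ::
  "('o, 'm, 'a) additive_category_scheme \<Rightarrow> ('p, 'n, 'b) additive_category_scheme \<Rightarrow>
   ('o \<Rightarrow> 'p) \<Rightarrow> ('m \<Rightarrow> 'n) \<Rightarrow> bool" where
  "is_additive_functor C D FO FM \<longleftrightarrow>
     is_functor C D FO FM \<and>
     (\<forall>x y. \<forall>f \<in> Hom C x y. \<forall>g \<in> Hom C x y. FM (Add C f g) = Add D (FM f) (FM g))"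


section \<open>Triangulated categories\<close>

text \<open>
  \<open>(f, g, h) \<in> Tri C\<close> stands for a distinguished triangle
  \<open>x \<rightarrow> y \<rightarrow> z \<rightarrow> \<Sigma>x\<close> with maps \<open>f\<close>, \<open>g\<close>,
  \<open>h\<close>. The shift \<open>(ShO, ShM)\<close> is an additive auto-equivalence, not necessarily a
  strict automorphism.
\<close>

record ('o, 'm) triangulated_category = "('o, 'm) additive_category" +
  ShO :: "'o \<Rightarrow> 'o"
  ShM :: "'m \<Rightarrow> 'm"
  Tri :: "('m \<times> 'm \<times> 'm) set"

definition candidate_triangles ::
  "('o, 'm, 'a) triangulated_category_scheme \<Rightarrow> ('m \<times> 'm \<times> 'm) set" where
  "candidate_triangles C =
     {(f, g, h). f \<in> Ar C \<and> g \<in> Ar C \<and> h \<in> Ar C \<and>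
        Tgt C f = Src C g \<and> Tgt C g = Src C h \<and> Tgt C h = ShO C (Src C f)}"

definition triangle_morphism ::
  "('o, 'm, 'a) triangulated_category_scheme \<Rightarrow>
   'm \<times> 'm \<times> 'm \<Rightarrow> 'm \<times> 'm \<times> 'm \<Rightarrow> 'm \<times> 'm \<times> 'm \<Rightarrow> bool" where
  "triangle_morphism C = (\<lambda>(f, g, h) (f', g', h') (a, b, c).
     a \<in> Hom C (Src C f) (Src C f') \<and>
     b \<in> Hom C (Src C g) (Src C g') \<and>
     c \<in> Hom C (Src C h) (Src C h') \<and>
     f' \<cdot>\<^bsub>C\<^esub> a = b \<cdot>\<^bsub>C\<^esub> f \<and>
     g' \<cdot>\<^bsub>C\<^esub> b = c \<cdot>\<^bsub>C\<^esub> g \<and>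
     h' \<cdot>\<^bsub>C\<^esub> c = ShM C a \<cdot>\<^bsub>C\<^esub> h)"

locale triangulated_category = additive_category C
  for C :: "('o, 'm, 'a) triangulated_category_scheme" (structure) +
  assumes shift_equivalence: "is_equivalence C C (ShO C) (ShM C)"
    and shift_additive: "is_additive_functor C C (ShO C) (ShM C)"
    and Tri_candidate: "Tri C \<subseteq> candidate_triangles C"
    and Tri_iso: "\<lbrakk>(f, g, h) \<in> Tri C; (f', g', h') \<in> candidate_triangles C;
          triangle_morphism C (f, g, h) (f', g', h') (a, b, c);
          a \<in> isomorphisms C (Src C f) (Src C f');
          b \<in> isomorphisms C (Src C g) (Src C g');
          c \<in> isomorphisms C (Src C h) (Src C h')\<rbrakk> \<Longrightarrow> (f', g', h') \<in> Tri C"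
    and Tri_Idn: "\<lbrakk>x \<in> Ob C; zero_object C z\<rbrakk> \<Longrightarrow>
          (Idn C x, Zer C x z, Zer C z (ShO C x)) \<in> Tri C"
    and Tri_cone: "f \<in> Ar C \<Longrightarrow> \<exists>g h. (f, g, h) \<in> Tri C"
    and Tri_rotate: "(f, g, h) \<in> candidate_triangles C \<Longrightarrow>
          (f, g, h) \<in> Tri C \<longleftrightarrow> (g, h, Neg C (ShM C f)) \<in> Tri C"
    and Tri_complete: "\<lbrakk>(f, g, h) \<in> Tri C; (f', g', h') \<in> Tri C;
          a \<in> Hom C (Src C f) (Src C f'); b \<in> Hom C (Src C g) (Src C g');
          f' \<cdot> a = b \<cdot> f\<rbrakk> \<Longrightarrow>
          \<exists>c. triangle_morphism C (f, g, h) (f', g', h') (a, b, c)"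
    and Tri_octahedral: "\<lbrakk>f \<in> Hom C x y; g \<in> Hom C y z;
          (f, f', f'') \<in> Tri C; (g, g', g'') \<in> Tri C; (g \<cdot> f, k', k'') \<in> Tri C\<rbrakk> \<Longrightarrow>
          \<exists>a \<in> Hom C (Tgt C f') (Tgt C k'). \<exists>b \<in> Hom C (Tgt C k') (Tgt C g').
            (a, b, ShM C f' \<cdot> g'') \<in> Tri C \<and>
            a \<cdot> f' = k' \<cdot> g \<and> k'' \<cdot> a = f'' \<and>
            b \<cdot> k' = g' \<and> g'' \<cdot> b = ShM C f \<cdot> k''"

definition is_exact_functor ::
  "('o, 'm, 'a) triangulated_category_scheme \<Rightarrow> ('p, 'n, 'b) triangulated_category_scheme \<Rightarrow>
   ('o \<Rightarrow> 'p) \<Rightarrow> ('m \<Rightarrow> 'n) \<Rightarrow> bool" where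
  "is_exact_functor C D FO FM \<longleftrightarrow>
     is_additive_functor C D FO FM \<and>
     (\<exists>\<theta>. is_natural_isomorphism C D
              (\<lambda>x. FO (ShO C x)) (\<lambda>f. FM (ShM C f)) (\<lambda>x. ShO D (FO x)) (\<lambda>f. ShM D (FM f)) \<theta> \<and>
          (\<forall>f g h. (f, g, h) \<in> Tri C \<longrightarrow>
             (FM f, FM g, \<theta> (Src C f) \<cdot>\<^bsub>D\<^esub> FM h) \<in> Tri D))"


section \<open>Monoidal-triangulated categories\<close>

record ('o, 'm) mt_category = "('o, 'm) triangulated_category" +
  TenO :: "'o \<Rightarrow> 'o \<Rightarrow> 'o" (infixr "\<otimes>\<^sub>o\<index>" 75)
  TenM :: "'m \<Rightarrow> 'm \<Rightarrow> 'm" (infixr "\<otimes>\<^sub>m\<index>" 75)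
  TUnit :: "'o"
  Associator :: "'o \<Rightarrow> 'o \<Rightarrow> 'o \<Rightarrow> 'm"
  LUnitor :: "'o \<Rightarrow> 'm"
  RUnitor :: "'o \<Rightarrow> 'm"

locale monoidal_category = category K
  for K :: "('o, 'm, 'a) mt_category_scheme" (structure) +
  assumes TUnit_closed: "TUnit K \<in> Ob K"
    and TenO_closed: "\<lbrakk>x \<in> Ob K; y \<in> Ob K\<rbrakk> \<Longrightarrow> x \<otimes>\<^sub>o y \<in> Ob K"
    and TenM_in_Hom: "\<lbrakk>f \<in> Hom K x x'; g \<in> Hom K y y'\<rbrakk> \<Longrightarrow>
          f \<otimes>\<^sub>m g \<in> Hom K (x \<otimes>\<^sub>o y) (x' \<otimes>\<^sub>o y')"
    and TenM_Idn: "\<lbrakk>x \<in> Ob K; y \<in> Ob K\<rbrakk> \<Longrightarrow>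
          Idn K x \<otimes>\<^sub>m Idn K y = Idn K (x \<otimes>\<^sub>o y)"
    and TenM_Cmp: "\<lbrakk>f \<in> Hom K x x'; f' \<in> Hom K x' x''; g \<in> Hom K y y'; g' \<in> Hom K y' y''\<rbrakk> \<Longrightarrow>
          (f' \<cdot> f) \<otimes>\<^sub>m (g' \<cdot> g) = (f' \<otimes>\<^sub>m g') \<cdot> (f \<otimes>\<^sub>m g)"
    and Associator_iso: "\<lbrakk>x \<in> Ob K; y \<in> Ob K; z \<in> Ob K\<rbrakk> \<Longrightarrow>
          Associator K x y z \<in> isomorphisms K ((x \<otimes>\<^sub>o y) \<otimes>\<^sub>o z) (x \<otimes>\<^sub>o (y \<otimes>\<^sub>o z))"
    and Associator_natural: "\<lbrakk>f \<in> Hom K x x'; g \<in> Hom K y y'; h \<in> Hom K z z'\<rbrakk> \<Longrightarrow>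
          Associator K x' y' z' \<cdot> ((f \<otimes>\<^sub>m g) \<otimes>\<^sub>m h) =
          (f \<otimes>\<^sub>m (g \<otimes>\<^sub>m h)) \<cdot> Associator K x y z"
    and LUnitor_natural: "is_natural_isomorphism K K
          (\<lambda>x. TUnit K \<otimes>\<^sub>o x) (\<lambda>f. Idn K (TUnit K) \<otimes>\<^sub>m f) (\<lambda>x. x) (\<lambda>f. f) (LUnitor K)"
    and RUnitor_natural: "is_natural_isomorphism K K
          (\<lambda>x. x \<otimes>\<^sub>o TUnit K) (\<lambda>f. f \<otimes>\<^sub>m Idn K (TUnit K)) (\<lambda>x. x) (\<lambda>f. f) (RUnitor K)"
    and pentagon: "\<lbrakk>w \<in> Ob K; x \<in> Ob K; y \<in> Ob K; z \<in> Ob K\<rbrakk> \<Longrightarrow>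
          Associator K w x (y \<otimes>\<^sub>o z) \<cdot> Associator K (w \<otimes>\<^sub>o x) y z =
          (Idn K w \<otimes>\<^sub>m Associator K x y z) \<cdot> Associator K w (x \<otimes>\<^sub>o y) z \<cdot>
            (Associator K w x y \<otimes>\<^sub>m Idn K z)"
    and unit_triangle: "\<lbrakk>x \<in> Ob K; y \<in> Ob K\<rbrakk> \<Longrightarrow>
          (Idn K x \<otimes>\<^sub>m LUnitor K y) \<cdot> Associator K x (TUnit K) y = RUnitor K x \<otimes>\<^sub>m Idn K y"

locale monoidal_triangulated_category = triangulated_category K + monoidal_category K
  for K :: "('o, 'm, 'a) mt_category_scheme" (structure) +
  assumes tensor_exact_left: "y \<in> Ob K \<Longrightarrow>
          is_exact_functor K K (\<lambda>x. x \<otimes>\<^sub>o y) (\<lambda>f. f \<otimes>\<^sub>m Idn K y)"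
    and tensor_exact_right: "x \<in> Ob K \<Longrightarrow>
          is_exact_functor K K (\<lambda>y. x \<otimes>\<^sub>o y) (\<lambda>f. Idn K x \<otimes>\<^sub>m f)"


section \<open>Thick tensor ideals\<close>

text \<open>Full subcategories are represented by their sets of objects.\<close>

definition triangulated_subcategory ::
  "('o, 'm, 'a) triangulated_category_scheme \<Rightarrow> 'o set \<Rightarrow> bool" where
  "triangulated_subcategory C I \<longleftrightarrow>
     I \<subseteq> Ob C \<and>
     (\<forall>z. zero_object C z \<longrightarrow> z \<in> I) \<and>
     (\<forall>x y. x \<in> I \<longrightarrow> isomorphisms C x y \<noteq> {} \<longrightarrow> y \<in> I) \<and>
     (\<forall>x \<in> Ob C. ShO C x \<in> I \<longleftrightarrow> x \<in> I) \<and>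
     (\<forall>f g h. (f, g, h) \<in> Tri C \<longrightarrow> Src C f \<in> I \<longrightarrow> Tgt C f \<in> I \<longrightarrow> Tgt C g \<in> I)"

definition thick_subcategory ::
  "('o, 'm, 'a) triangulated_category_scheme \<Rightarrow> 'o set \<Rightarrow> bool" where
  "thick_subcategory C I \<longleftrightarrow>
     triangulated_subcategory C I \<and>
     (\<forall>x y s. is_biproduct C x y s \<longrightarrow> s \<in> I \<longrightarrow> x \<in> I \<and> y \<in> I)"

definition thick_tensor_ideal :: "('o, 'm, 'a) mt_category_scheme \<Rightarrow> 'o set \<Rightarrow> bool" where
  "thick_tensor_ideal K I \<longleftrightarrow>
     thick_subcategory K I \<and>
     (\<forall>x \<in> I. \<forall>y \<in> Ob K. x \<otimes>\<^sub>o\<^bsub>K\<^esub> y \<in> I \<and> y \<otimes>\<^sub>o\<^bsub>K\<^esub> x \<in> I)"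

definition prime_tensor_ideal :: "('o, 'm, 'a) mt_category_scheme \<Rightarrow> 'o set \<Rightarrow> bool" where
  "prime_tensor_ideal K P \<longleftrightarrow>
     thick_tensor_ideal K P \<and> P \<noteq> Ob K \<and>
     (\<forall>I J. thick_tensor_ideal K I \<longrightarrow> thick_tensor_ideal K J \<longrightarrow>
        {x \<otimes>\<^sub>o\<^bsub>K\<^esub> y |x y. x \<in> I \<and> y \<in> J} \<subseteq> P \<longrightarrow> I \<subseteq> P \<or> J \<subseteq> P)"

definition Spc :: "('o, 'm, 'a) mt_category_scheme \<Rightarrow> 'o set set" where
  "Spc K = {P. prime_tensor_ideal K P}"

definition supp :: "('o, 'm, 'a) mt_category_scheme \<Rightarrow> 'o \<Rightarrow> 'o set set" where
  "supp K x = {P \<in> Spc K. x \<notin> P}"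

text \<open>Intersecting with \<open>Ob K\<close> makes the empty intersection the whole category.\<close>

definition semiprime_tensor_ideal :: "('o, 'm, 'a) mt_category_scheme \<Rightarrow> 'o set \<Rightarrow> bool" where
  "semiprime_tensor_ideal K I \<longleftrightarrow> (\<exists>S \<subseteq> Spc K. I = Ob K \<inter> \<Inter>S)"

definition semiprime_lattice :: "('o, 'm, 'a) mt_category_scheme \<Rightarrow> 'o set gorder" where
  "semiprime_lattice K = \<lparr>carrier = {I. semiprime_tensor_ideal K I}, eq = (=), le = (\<subseteq>)\<rparr>"

text \<open>
  The HOL function \<open>topology\<close> is total: \<open>openin (Spc_nu K)\<close> consists of the unions
  of supports only because these unions do form a topology.
\<close>

definition Spc_nu :: "('o, 'm, 'a) mt_category_scheme \<Rightarrow> 'o set topology" where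
  "Spc_nu K = topology (arbitrary union_of (\<lambda>U. \<exists>x \<in> Ob K. U = supp K x))"


section \<open>Lattices and frames\<close>

definition open_lattice :: "'a topology \<Rightarrow> 'a set gorder" where
  "open_lattice X = \<lparr>carrier = {U. openin X U}, eq = (=), le = (\<subseteq>)\<rparr>"

definition frame :: "('a, 'b) gorder_scheme \<Rightarrow> bool" where
  "frame L \<longleftrightarrow>
     complete_lattice L \<and>
     (\<forall>x \<in> carrier L. \<forall>A \<subseteq> carrier L. x \<sqinter>\<^bsub>L\<^esub> \<Squnion>\<^bsub>L\<^esub> A = \<Squnion>\<^bsub>L\<^esub> ((\<lambda>a. x \<sqinter>\<^bsub>L\<^esub> a) ` A))"

text \<open>\<open>join_pres\<close> and \<open>meet_pres\<close> include that both orders are lattices.\<close>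

definition lattice_isomorphism ::
  "('a, 'c) gorder_scheme \<Rightarrow> ('b, 'd) gorder_scheme \<Rightarrow> ('a \<Rightarrow> 'b) \<Rightarrow> bool" where
  "lattice_isomorphism L M f \<longleftrightarrow>
     bij_betw f (carrier L) (carrier M) \<and> join_pres L M f \<and> meet_pres L M f"

definition frame_isomorphism ::
  "('a, 'c) gorder_scheme \<Rightarrow> ('b, 'd) gorder_scheme \<Rightarrow> ('a \<Rightarrow> 'b) \<Rightarrow> bool" where
  "frame_isomorphism L M f \<longleftrightarrow>
     frame L \<and> frame M \<and> bij_betw f (carrier L) (carrier M) \<and>
     sup_pres L M f \<and> meet_pres L M f \<and> f \<top>\<^bsub>L\<^esub> = \<top>\<^bsub>M\<^esub>"

end

theory Submission
  imports Defs
begin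

text \<open>
  The supports form a base of a topology because a prime \<open>P\<close> with
  \<open>x, y \<notin> P\<close> satisfies \<open>x \<otimes> z \<otimes> y \<notin> P\<close> for some \<open>z\<close>,
  so that \<open>supp x \<inter> supp y\<close> is the union of the \<open>supp (x \<otimes> z \<otimes> y)\<close>. The
  elementwise form of primeness comes from the fact that an exact functor pulls thick
  subcategories back to thick subcategories: if \<open>x \<otimes> z \<otimes> y \<in> P\<close> for all
  \<open>z\<close>, then \<open>I = {a. \<forall>z. a \<otimes> z \<otimes> y \<in> P}\<close> and
  \<open>J = {b. \<forall>a \<in> I. a \<otimes> b \<in> P}\<close> are thick ideals with
  \<open>I \<otimes> J \<subseteq> P\<close>, \<open>x \<in> I\<close> and \<open>y \<in> J\<close>. The map of the theorem sends
  \<open>I\<close> to \<open>{P. \<not> I \<subseteq> P}\<close>, and a semiprime ideal is the intersection of the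
  primes containing it; hence the map is an isomorphism of ordered sets, and the frame structure is
  transported from the open sets.
\<close>

section \<open>Order isomorphisms and frames\<close>

text \<open>A bijection that preserves and reflects the order carries the upper bounds of
  \<open>A\<close> onto the upper bounds of its image, so the least elements of the two sets
  correspond. Only the bare relation enters, so the argument also serves for reversed
  orders.\<close>

lemma order_iso_is_lub_iff:
  assumes f: "bij_betw f (carrier L) (carrier M)"
    and le: "\<And>x y. x \<in> carrier L \<Longrightarrow> y \<in> carrier L \<Longrightarrow> f x \<sqsubseteq>\<^bsub>M\<^esub> f y \<longleftrightarrow> x \<sqsubseteq>\<^bsub>L\<^esub> y"
    and "A \<subseteq> carrier L" "x \<in> carrier L"
  shows "is_lub M (f x) (f ` A) \<longleftrightarrow> is_lub L x A"
proof -
  have im: "f ` carrier L = carrier M"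
    using f by (simp add: bij_betw_def)
  have "Upper M (f ` A) = f ` Upper L A"
  proof (intro equalityI subsetI)
    fix u assume u: "u \<in> Upper M (f ` A)"
    then have "u \<in> f ` carrier L"
      by (simp add: im Upper_def)
    then obtain v where v: "v \<in> carrier L" "u = f v"
      by auto
    have "x \<sqsubseteq>\<^bsub>L\<^esub> v" if "x \<in> A" for x
    proof -
      have "x \<in> carrier L" "f x \<in> carrier M"
        using that assms(3) im by auto
      then show ?thesis
        using u v that le[of x v] by (simp add: Upper_def)
    qed
    then show "u \<in> f ` Upper L A"
      using v by (auto simp: Upper_def)
  next
    fix u assume "u \<in> f ` Upper L A"
    then obtain v where v: "v \<in> carrier L" "u = f v" "\<And>x. x \<in> A \<inter> carrier L \<Longrightarrow> x \<sqsubseteq>\<^bsub>L\<^esub> v"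
      by (auto simp: Upper_def)
    have "f x \<sqsubseteq>\<^bsub>M\<^esub> u" if "x \<in> A" for x
      using that v le[of x v] assms(3) by blast
    then show "u \<in> Upper M (f ` A)"
      using v(1,2) im by (auto simp: Upper_def)
  qed
  moreover have "f x \<in> f ` Upper L A \<longleftrightarrow> x \<in> Upper L A"
    using inj_on_image_mem_iff[of f "carrier L" x "Upper L A"] f assms(4)
    by (auto simp: bij_betw_def)
  moreover have "f ` Upper L A \<subseteq> carrier M"
    by (auto simp: Upper_def im[symmetric])
  ultimately show ?thesis
    using le assms(4) unfolding least_def by (auto simp: Upper_def)
qed

text \<open>Duality: \<open>inv_gorder\<close> keeps the carrier and reverses the relation, which
  turns greatest lower bounds into least upper bounds.\<close>

lemma order_iso_is_glb_iff:
  assumes f: "bij_betw f (carrier L) (carrier M)"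
    and le: "\<And>x y. x \<in> carrier L \<Longrightarrow> y \<in> carrier L \<Longrightarrow> f x \<sqsubseteq>\<^bsub>M\<^esub> f y \<longleftrightarrow> x \<sqsubseteq>\<^bsub>L\<^esub> y"
    and "A \<subseteq> carrier L" "x \<in> carrier L"
  shows "is_glb M (f x) (f ` A) \<longleftrightarrow> is_glb L x A"
  using order_iso_is_lub_iff[of f "inv_gorder L" "inv_gorder M" A x] assms by simp

lemma (in complete_lattice) sup_eqI:
  "is_lub L s A \<Longrightarrow> A \<subseteq> carrier L \<Longrightarrow> \<Squnion>A = s"
  by (rule supI) (auto intro: least_unique)

lemma (in complete_lattice) inf_eqI:
  "is_glb L i A \<Longrightarrow> A \<subseteq> carrier L \<Longrightarrow> \<Sqinter>A = i"
  by (rule infI) (auto intro: greatest_unique)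

text \<open>Completeness is pulled back along \<open>f\<close>: the bound that exists in
  \<open>M\<close> for the image of a set lies in the carrier, hence has a preimage, and this
  preimage is the bound in \<open>L\<close>.\<close>

lemma order_iso_complete_lattice:
  assumes "partial_order L" "complete_lattice M"
    and f: "bij_betw f (carrier L) (carrier M)"
    and le: "\<And>x y. x \<in> carrier L \<Longrightarrow> y \<in> carrier L \<Longrightarrow> f x \<sqsubseteq>\<^bsub>M\<^esub> f y \<longleftrightarrow> x \<sqsubseteq>\<^bsub>L\<^esub> y"
  shows "complete_lattice L" "sup_pres L M f" "inf_pres L M f"
proof -
  interpret L: partial_order L by fact
  interpret M: complete_lattice M by fact
  have im: "f ` carrier L = carrier M"
    using f by (simp add: bij_betw_def)
  show L: "complete_lattice L"
  proof (rule L.complete_latticeI)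
    fix A assume A: "A \<subseteq> carrier L"
    then have fA: "f ` A \<subseteq> carrier M"
      using im by blast
    obtain s where "is_lub M s (f ` A)"
      using M.sup_exists[OF fA] by blast
    moreover from this obtain x where "x \<in> carrier L" "s = f x"
      using im least_closed[of M s] Upper_closed[of M "f ` A"] by (metis imageE)
    ultimately show "\<exists>s. is_lub L s A"
      using order_iso_is_lub_iff[OF f le A] by blast
    obtain i where "is_glb M i (f ` A)"
      using M.inf_exists[OF fA] by blast
    moreover from this obtain x where "x \<in> carrier L" "i = f x"
      using im greatest_closed[of M i] Lower_closed[of M "f ` A"] by (metis imageE)
    ultimately show "\<exists>i. is_glb L i A"
      using order_iso_is_glb_iff[OF f le A] by blast
  qed
  interpret L: complete_lattice L by fact
  show "sup_pres L M f"
    unfolding sup_pres_def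
  proof (intro conjI allI impI L \<open>complete_lattice M\<close>)
    fix A assume A: "A \<subseteq> carrier L"
    have "is_lub L (\<Squnion>\<^bsub>L\<^esub> A) A"
      by (rule L.supI) (use A in auto)
    then have "is_lub M (f (\<Squnion>\<^bsub>L\<^esub> A)) (f ` A)"
      using order_iso_is_lub_iff[OF f le A] L.sup_closed[OF A] by blast
    then show "f (\<Squnion>\<^bsub>L\<^esub> A) = \<Squnion>\<^bsub>M\<^esub> (f ` A)"
      by (rule M.sup_eqI[symmetric]) (use A im in auto)
  qed
  show "inf_pres L M f"
    unfolding inf_pres_def
  proof (intro conjI allI impI L \<open>complete_lattice M\<close>)
    fix A assume A: "A \<subseteq> carrier L"
    have "is_glb L (\<Sqinter>\<^bsub>L\<^esub> A) A"
      by (rule L.infI) (use A in auto)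
    then have "is_glb M (f (\<Sqinter>\<^bsub>L\<^esub> A)) (f ` A)"
      using order_iso_is_glb_iff[OF f le A] L.inf_closed[OF A] by blast
    then show "f (\<Sqinter>\<^bsub>L\<^esub> A) = \<Sqinter>\<^bsub>M\<^esub> (f ` A)"
      by (rule M.inf_eqI[symmetric]) (use A im in auto)
  qed
qed

text \<open>This reduces the theorem to an order comparison: only \<open>M\<close> has to be known
  to be a frame, and \<open>L\<close> inherits the frame law because \<open>f\<close> is injective
  and preserves suprema and meets.\<close>

lemma order_iso_frame_isomorphism:
  assumes "partial_order L" "frame M"
    and f: "bij_betw f (carrier L) (carrier M)"
    and le: "\<And>x y. x \<in> carrier L \<Longrightarrow> y \<in> carrier L \<Longrightarrow> f x \<sqsubseteq>\<^bsub>M\<^esub> f y \<longleftrightarrow> x \<sqsubseteq>\<^bsub>L\<^esub> y"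
  shows "lattice_isomorphism L M f" "frame_isomorphism L M f"
proof -
  have "complete_lattice M"
    using \<open>frame M\<close> by (simp add: frame_def)
  note pres = order_iso_complete_lattice[OF \<open>partial_order L\<close> this f le]
  interpret L: complete_lattice L by (rule pres)
  interpret M: complete_lattice M by fact
  have im: "f ` carrier L = carrier M" and inj: "inj_on f (carrier L)"
    using f by (simp_all add: bij_betw_def)
  have join: "join_pres L M f" and meet: "meet_pres L M f"
    using pres weak_sup_pres sup_pres_is_join_pres weak_inf_pres inf_pres_is_meet_pres by blast+
  have f_sup: "f (\<Squnion>\<^bsub>L\<^esub> A) = \<Squnion>\<^bsub>M\<^esub> (f ` A)" if "A \<subseteq> carrier L" for A
    using pres(2) that by (simp add: sup_pres_def)
  have f_meet: "f (x \<sqinter>\<^bsub>L\<^esub> y) = f x \<sqinter>\<^bsub>M\<^esub> f y" if "x \<in> carrier L" "y \<in> carrier L" for x y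
    using meet that by (simp add: meet_pres_def)
  have "x \<sqinter>\<^bsub>L\<^esub> \<Squnion>\<^bsub>L\<^esub> A = \<Squnion>\<^bsub>L\<^esub> ((\<lambda>a. x \<sqinter>\<^bsub>L\<^esub> a) ` A)"
    if x: "x \<in> carrier L" and A: "A \<subseteq> carrier L" for x A
  \<comment> \<open>The two sides are compared after applying \<open>f\<close>, where the equation
    becomes the distributive law of \<open>M\<close>.\<close>
  proof (rule inj_onD[OF inj])
    have xA: "(\<lambda>a. x \<sqinter>\<^bsub>L\<^esub> a) ` A \<subseteq> carrier L"
      using x A by auto
    have "f (x \<sqinter>\<^bsub>L\<^esub> \<Squnion>\<^bsub>L\<^esub> A) = f x \<sqinter>\<^bsub>M\<^esub> \<Squnion>\<^bsub>M\<^esub> (f ` A)"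
      using x A by (simp add: f_meet f_sup)
    also have "\<dots> = \<Squnion>\<^bsub>M\<^esub> ((\<lambda>b. f x \<sqinter>\<^bsub>M\<^esub> b) ` f ` A)"
    proof -
      have "f x \<in> carrier M" "f ` A \<subseteq> carrier M"
        using x A im by blast+
      then show ?thesis
        using \<open>frame M\<close> by (simp add: frame_def)
    qed
    also have "(\<lambda>b. f x \<sqinter>\<^bsub>M\<^esub> b) ` f ` A = f ` (\<lambda>a. x \<sqinter>\<^bsub>L\<^esub> a) ` A"
      unfolding image_image by (rule image_cong) (use x A f_meet in auto)
    also have "\<Squnion>\<^bsub>M\<^esub> \<dots> = f (\<Squnion>\<^bsub>L\<^esub> ((\<lambda>a. x \<sqinter>\<^bsub>L\<^esub> a) ` A))"
      using f_sup[OF xA] by simp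
    finally show "f (x \<sqinter>\<^bsub>L\<^esub> \<Squnion>\<^bsub>L\<^esub> A) = f (\<Squnion>\<^bsub>L\<^esub> ((\<lambda>a. x \<sqinter>\<^bsub>L\<^esub> a) ` A))" .
    show "\<Squnion>\<^bsub>L\<^esub> ((\<lambda>a. x \<sqinter>\<^bsub>L\<^esub> a) ` A) \<in> carrier L"
      using xA by (rule L.sup_closed)
  qed (use x A in simp)
  then have "frame L"
    using pres(1) by (simp add: frame_def)
  moreover have "f \<top>\<^bsub>L\<^esub> = \<top>\<^bsub>M\<^esub>"
  proof (rule M.le_antisym)
    \<comment> \<open>The top of \<open>M\<close> is the image of some \<open>x\<close> below the
      top of \<open>L\<close>, and \<open>f\<close> is monotone.\<close>
    obtain x where x: "x \<in> carrier L" "\<top>\<^bsub>M\<^esub> = f x"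
      using im M.top_closed by blast
    then show "\<top>\<^bsub>M\<^esub> \<sqsubseteq>\<^bsub>M\<^esub> f \<top>\<^bsub>L\<^esub>"
      using le by simp
  qed (use im in auto)
  ultimately show "frame_isomorphism L M f"
    using \<open>frame M\<close> f pres(2) meet by (simp add: frame_isomorphism_def)
  show "lattice_isomorphism L M f"
    using f join meet by (simp add: lattice_isomorphism_def)
qed

section \<open>Families of sets ordered by inclusion, and the frame of open sets\<close>

lemma partial_order_inclusion: "partial_order \<lparr>carrier = S, eq = (=), le = (\<subseteq>)\<rparr>"
  by unfold_locales auto

text \<open>Suprema are unions and binary meets are intersections, so the frame law is the
  distributivity of intersection over unions.\<close>

lemma frame_open_lattice: "frame (open_lattice X)"
proof -
  interpret partial_order "open_lattice X"
    unfolding open_lattice_def by (rule partial_order_inclusion)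
  have lub: "is_lub (open_lattice X) (\<Union>\<U>) \<U>" if "\<U> \<subseteq> carrier (open_lattice X)" for \<U>
    using that unfolding least_def Upper_def by (auto simp: open_lattice_def)
  \<comment> \<open>The union of all open lower bounds is the interior of the intersection of the
    family; for the empty family it is the whole space.\<close>
  have glb: "is_glb (open_lattice X) (\<Union>(Lower (open_lattice X) \<U>)) \<U>"
    if "\<U> \<subseteq> carrier (open_lattice X)" for \<U>
    using that unfolding greatest_def Lower_def by (auto simp: open_lattice_def)
  interpret complete_lattice "open_lattice X"
    by (rule complete_latticeI) (use lub glb in blast)+
  have meet: "U \<sqinter>\<^bsub>open_lattice X\<^esub> V = U \<inter> V"
    if "U \<in> carrier (open_lattice X)" "V \<in> carrier (open_lattice X)" for U V
    unfolding meet_def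
    by (rule inf_eqI) (use that in \<open>auto simp: greatest_def Lower_def open_lattice_def\<close>)
  have "U \<sqinter>\<^bsub>open_lattice X\<^esub> \<Squnion>\<^bsub>open_lattice X\<^esub> \<U> =
      \<Squnion>\<^bsub>open_lattice X\<^esub> ((\<lambda>V. U \<sqinter>\<^bsub>open_lattice X\<^esub> V) ` \<U>)"
    if U: "U \<in> carrier (open_lattice X)" and \<U>: "\<U> \<subseteq> carrier (open_lattice X)" for U \<U>
  proof -
    have "U \<sqinter>\<^bsub>open_lattice X\<^esub> \<Squnion>\<^bsub>open_lattice X\<^esub> \<U> = U \<inter> \<Union>\<U>"
      using meet[OF U] sup_closed[OF \<U>] sup_eqI[OF lub[OF \<U>] \<U>] by simp
    also have "\<dots> = \<Union>((\<lambda>V. U \<inter> V) ` \<U>)"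
      by blast
    also have "(\<lambda>V. U \<inter> V) ` \<U> = (\<lambda>V. U \<sqinter>\<^bsub>open_lattice X\<^esub> V) ` \<U>"
      by (rule image_cong) (use meet[OF U] \<U> in auto)
    also have "\<Union>\<dots> = \<Squnion>\<^bsub>open_lattice X\<^esub> ((\<lambda>V. U \<sqinter>\<^bsub>open_lattice X\<^esub> V) ` \<U>)"
    proof -
      have "(\<lambda>V. U \<sqinter>\<^bsub>open_lattice X\<^esub> V) ` \<U> \<subseteq> carrier (open_lattice X)"
        using U \<U> by auto
      then show ?thesis
        using sup_eqI[OF lub] by simp
    qed
    finally show ?thesis .
  qed
  then show ?thesis
    using complete_lattice_axioms by (simp add: frame_def)
qed

section \<open>Exact functors and thick subcategories\<close>

lemma (in category) Hom_objects: "f \<in> Hom C x y \<Longrightarrow> x \<in> Ob C \<and> y \<in> Ob C"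
  using Src_closed Tgt_closed by (auto simp: Hom_def)

lemma (in category) isomorphisms_sym: "isomorphisms C x y \<noteq> {} \<Longrightarrow> isomorphisms C y x \<noteq> {}"
  unfolding isomorphisms_def by blast

lemma is_functor_isomorphisms:
  assumes "is_functor C D FO FM" "category C" "isomorphisms C x y \<noteq> {}"
  shows "isomorphisms D (FO x) (FO y) \<noteq> {}"
proof -
  interpret category C by fact
  obtain f g where fg: "f \<in> Hom C x y" "g \<in> Hom C y x"
      "g \<cdot>\<^bsub>C\<^esub> f = Idn C x" "f \<cdot>\<^bsub>C\<^esub> g = Idn C y"
    using assms(3) unfolding isomorphisms_def by blast
  moreover have "x \<in> Ob C" "y \<in> Ob C"
    using Hom_objects fg(1) by blast+
  moreover have "FM g \<cdot>\<^bsub>D\<^esub> FM f = FM (g \<cdot>\<^bsub>C\<^esub> f)" "FM f \<cdot>\<^bsub>D\<^esub> FM g = FM (f \<cdot>\<^bsub>C\<^esub> g)"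
    using assms(1) fg(1,2) unfolding is_functor_def by metis+
  moreover have "FM f \<in> Hom D (FO x) (FO y)" "FM g \<in> Hom D (FO y) (FO x)"
    using assms(1) fg(1,2) unfolding is_functor_def by blast+
  ultimately have "FM f \<in> isomorphisms D (FO x) (FO y)"
    using assms(1) unfolding is_functor_def isomorphisms_def by auto
  then show ?thesis
    by blast
qed

section \<open>Zero morphisms, zero objects and biproducts under additive functors\<close>

lemma (in additive_category) Zer_in_Hom:
  assumes "x \<in> Ob C" "y \<in> Ob C" shows "Zer C x y \<in> Hom C x y"
proof -
  interpret G: comm_group "hom_group C x y"
    by (rule hom_comm_group[OF assms])
  show ?thesis
    using G.one_closed by (simp add: hom_group_def)
qed

text \<open>The neutral element is the only idempotent of a group. This describes zero morphisms by
  an equation that composition and additive functors visibly preserve.\<close>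

lemma (in additive_category) Add_idem_eq_Zer:
  assumes "f \<in> Hom C x y" "Add C f f = f" shows "f = Zer C x y"
proof -
  interpret G: comm_group "hom_group C x y"
    using Hom_objects[OF assms(1)] by (intro hom_comm_group) auto
  show ?thesis
    using G.l_cancel_one[of f f] assms by (simp add: hom_group_def)
qed

lemma (in additive_category) Add_Zer:
  assumes "x \<in> Ob C" "y \<in> Ob C" shows "Add C (Zer C x y) (Zer C x y) = Zer C x y"
proof -
  interpret G: comm_group "hom_group C x y"
    by (rule hom_comm_group[OF assms])
  show ?thesis
    using G.l_one[OF G.one_closed] by (simp add: hom_group_def)
qed

lemma (in additive_category) Zer_Cmp:
  assumes "f \<in> Hom C w x" "y \<in> Ob C" shows "Zer C x y \<cdot> f = Zer C w y"
proof (rule Add_idem_eq_Zer)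
  have x: "x \<in> Ob C"
    using Hom_objects assms(1) by blast
  note Z = Zer_in_Hom[OF x assms(2)]
  show "Zer C x y \<cdot> f \<in> Hom C w y"
    by (rule Cmp_in_Hom[OF assms(1) Z])
  show "Add C (Zer C x y \<cdot> f) (Zer C x y \<cdot> f) = Zer C x y \<cdot> f"
    using Cmp_Add_left[OF assms(1) Z Z] Add_Zer[OF x assms(2)] by simp
qed

lemma (in additive_category) Cmp_Zer:
  assumes "g \<in> Hom C x y" "w \<in> Ob C" shows "g \<cdot> Zer C w x = Zer C w y"
proof (rule Add_idem_eq_Zer)
  have x: "x \<in> Ob C"
    using Hom_objects assms(1) by blast
  note Z = Zer_in_Hom[OF assms(2) x]
  show "g \<cdot> Zer C w x \<in> Hom C w y"
    by (rule Cmp_in_Hom[OF Z assms(1)])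
  show "Add C (g \<cdot> Zer C w x) (g \<cdot> Zer C w x) = g \<cdot> Zer C w x"
    using Cmp_Add_right[OF Z Z assms(1)] Add_Zer[OF assms(2) x] by simp
qed

text \<open>Every morphism into or out of \<open>z\<close> is its own composite with the identity of
  \<open>z\<close>, hence zero once that identity is. Unlike the universal property, the equation
  can be transported by an additive functor.\<close>

lemma (in additive_category) zero_object_iff:
  "zero_object C z \<longleftrightarrow> z \<in> Ob C \<and> Idn C z = Zer C z z"
proof
  assume "zero_object C z"
  then show "z \<in> Ob C \<and> Idn C z = Zer C z z"
    using Idn_in_Hom Zer_in_Hom unfolding zero_object_def by blast
next
  assume z: "z \<in> Ob C \<and> Idn C z = Zer C z z"
  have "f = Zer C x z" if "f \<in> Hom C x z" for f x
    using Idn_Cmp[OF that] Zer_Cmp[OF that] z by simp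
  moreover have "f = Zer C z x" if "f \<in> Hom C z x" for f x
    using Cmp_Idn[OF that] Cmp_Zer[OF that] z by simp
  ultimately show "zero_object C z"
    using z Zer_in_Hom unfolding zero_object_def by blast
qed

lemma is_additive_functor_Zer:
  assumes "is_additive_functor C D FO FM" "additive_category C" "additive_category D"
    and "x \<in> Ob C" "y \<in> Ob C"
  shows "FM (Zer C x y) = Zer D (FO x) (FO y)"
proof -
  interpret C: additive_category C by fact
  interpret D: additive_category D by fact
  note Z = C.Zer_in_Hom[OF assms(4,5)]
  have "FM (Zer C x y) \<in> Hom D (FO x) (FO y)"
    using assms(1) Z unfolding is_additive_functor_def is_functor_def by blast
  moreover have "Add D (FM (Zer C x y)) (FM (Zer C x y)) = FM (Zer C x y)"
    using assms(1) Z C.Add_Zer[OF assms(4,5)] unfolding is_additive_functor_def by metis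
  ultimately show ?thesis
    by (rule D.Add_idem_eq_Zer)
qed

lemma is_additive_functor_zero_object:
  assumes "is_additive_functor C D FO FM" "additive_category C" "additive_category D"
    and "zero_object C z"
  shows "zero_object D (FO z)"
proof -
  interpret C: additive_category C by fact
  interpret D: additive_category D by fact
  have z: "z \<in> Ob C" "Idn C z = Zer C z z"
    using assms(4) by (auto simp: C.zero_object_iff)
  then have "FO z \<in> Ob D" "FM (Idn C z) = Idn D (FO z)"
    using assms(1) unfolding is_additive_functor_def is_functor_def by blast+
  then show ?thesis
    using is_additive_functor_Zer[OF assms(1-3) z(1) z(1)] z(2) by (simp add: D.zero_object_iff)
qed

text \<open>Biproducts are defined by maps and equations between them, all of which an additive
  functor preserves.\<close>

lemma is_additive_functor_biproduct:
  assumes F: "is_additive_functor C D FO FM" and "additive_category C" "additive_category D"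
    and "is_biproduct C x y s"
  shows "is_biproduct D (FO x) (FO y) (FO s)"
proof -
  interpret C: additive_category C by fact
  obtain i j p q where ob: "x \<in> Ob C" "y \<in> Ob C" "s \<in> Ob C"
    and hom: "i \<in> Hom C x s" "j \<in> Hom C y s" "p \<in> Hom C s x" "q \<in> Hom C s y"
    and eq: "p \<cdot>\<^bsub>C\<^esub> i = Idn C x" "q \<cdot>\<^bsub>C\<^esub> j = Idn C y"
      "q \<cdot>\<^bsub>C\<^esub> i = Zer C x y" "p \<cdot>\<^bsub>C\<^esub> j = Zer C y x"
      "Add C (i \<cdot>\<^bsub>C\<^esub> p) (j \<cdot>\<^bsub>C\<^esub> q) = Idn C s"
    using assms(4) unfolding is_biproduct_def by blast
  have cmp: "FM (g \<cdot>\<^bsub>C\<^esub> f) = FM g \<cdot>\<^bsub>D\<^esub> FM f" if "f \<in> Hom C u v" "g \<in> Hom C v w" for f g u v w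
    using F that unfolding is_additive_functor_def is_functor_def by blast
  have idn: "FM (Idn C u) = Idn D (FO u)" "FO u \<in> Ob D" if "u \<in> Ob C" for u
    using F that unfolding is_additive_functor_def is_functor_def by blast+
  have hom': "FM f \<in> Hom D (FO u) (FO v)" if "f \<in> Hom C u v" for f u v
    using F that unfolding is_additive_functor_def is_functor_def by blast
  have add: "FM (Add C f g) = Add D (FM f) (FM g)" if "f \<in> Hom C u v" "g \<in> Hom C u v" for f g u v
    using F that unfolding is_additive_functor_def by blast
  note zer = is_additive_functor_Zer[OF assms(1-3)]
  have "FM p \<cdot>\<^bsub>D\<^esub> FM i = Idn D (FO x)" "FM q \<cdot>\<^bsub>D\<^esub> FM j = Idn D (FO y)"
    using cmp hom eq idn ob by metis+
  moreover have "FM q \<cdot>\<^bsub>D\<^esub> FM i = Zer D (FO x) (FO y)" "FM p \<cdot>\<^bsub>D\<^esub> FM j = Zer D (FO y) (FO x)"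
    using cmp hom eq zer ob by metis+
  moreover have "Add D (FM i \<cdot>\<^bsub>D\<^esub> FM p) (FM j \<cdot>\<^bsub>D\<^esub> FM q) = Idn D (FO s)"
    using add[OF C.Cmp_in_Hom[OF hom(3,1)] C.Cmp_in_Hom[OF hom(4,2)]]
      cmp[OF hom(3,1)] cmp[OF hom(4,2)] eq(5) idn(1)[OF ob(3)] by simp
  ultimately show ?thesis
    using idn(2) ob hom'[OF hom(1)] hom'[OF hom(2)] hom'[OF hom(3)] hom'[OF hom(4)]
    unfolding is_biproduct_def by blast
qed

section \<open>Thick subcategories, their inverse images and intersections\<close>

lemma thick_subcategoryI:
  assumes "I \<subseteq> Ob C" "\<And>z. zero_object C z \<Longrightarrow> z \<in> I"
    and "\<And>x y. x \<in> I \<Longrightarrow> isomorphisms C x y \<noteq> {} \<Longrightarrow> y \<in> I"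
    and "\<And>x. x \<in> Ob C \<Longrightarrow> ShO C x \<in> I \<longleftrightarrow> x \<in> I"
    and "\<And>f g h. (f, g, h) \<in> Tri C \<Longrightarrow> Src C f \<in> I \<Longrightarrow> Tgt C f \<in> I \<Longrightarrow> Tgt C g \<in> I"
    and "\<And>x y s. is_biproduct C x y s \<Longrightarrow> s \<in> I \<Longrightarrow> x \<in> I \<and> y \<in> I"
  shows "thick_subcategory C I"
  unfolding thick_subcategory_def triangulated_subcategory_def
  apply (intro conjI[OF conjI[OF assms(1) conjI[OF _ conjI[OF _ conjI]]]] allI impI ballI)
  subgoal by (rule assms(2))
  subgoal by (rule assms(3))
  subgoal by (rule assms(4))
  subgoal by (rule assms(5))
  subgoal by (rule assms(6))
  done

lemma thick_subcategoryD:
  assumes "thick_subcategory C I"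
  shows "I \<subseteq> Ob C" "zero_object C z \<Longrightarrow> z \<in> I"
    and "x \<in> I \<Longrightarrow> isomorphisms C x y \<noteq> {} \<Longrightarrow> y \<in> I"
    and "x \<in> Ob C \<Longrightarrow> ShO C x \<in> I \<longleftrightarrow> x \<in> I"
    and "(f, g, h) \<in> Tri C \<Longrightarrow> Src C f \<in> I \<Longrightarrow> Tgt C f \<in> I \<Longrightarrow> Tgt C g \<in> I"
    and "is_biproduct C x y s \<Longrightarrow> s \<in> I \<Longrightarrow> x \<in> I \<and> y \<in> I"
  using assms unfolding thick_subcategory_def triangulated_subcategory_def by blast+

lemma thick_subcategory_iso:
  "thick_subcategory C P \<Longrightarrow> isomorphisms C x y \<noteq> {} \<Longrightarrow> x \<in> P \<Longrightarrow> y \<in> P"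
  unfolding thick_subcategory_def triangulated_subcategory_def by blast

lemma thick_subcategory_iso_iff:
  "thick_subcategory C P \<Longrightarrow> category C \<Longrightarrow> isomorphisms C x y \<noteq> {} \<Longrightarrow> x \<in> P \<longleftrightarrow> y \<in> P"
  using thick_subcategory_iso category.isomorphisms_sym by metis

text \<open>Each closure condition rests on one preserved structure: isomorphisms by functoriality,
  zero objects and biproducts by additivity, shifts through \<open>\<theta>\<close>, and cones by
  preservation of distinguished triangles.\<close>

lemma thick_subcategory_vimage:
  assumes F: "is_exact_functor C D FO FM"
    and "triangulated_category C" "triangulated_category D" and P: "thick_subcategory D P"
  shows "thick_subcategory C {x \<in> Ob C. FO x \<in> P}"
proof -
  interpret C: triangulated_category C by fact
  interpret D: triangulated_category D by fact
  have add: "is_additive_functor C D FO FM" and "is_functor C D FO FM"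
    using F by (auto simp: is_exact_functor_def is_additive_functor_def)
  then have hom: "FM f \<in> Hom D (FO x) (FO y)" if "f \<in> Hom C x y" for f x y
    using that unfolding is_functor_def by blast
  obtain \<theta> where \<theta>: "is_natural_isomorphism C D
      (\<lambda>x. FO (ShO C x)) (\<lambda>f. FM (ShM C f)) (\<lambda>x. ShO D (FO x)) (\<lambda>f. ShM D (FM f)) \<theta>"
    and tri: "\<And>f g h. (f, g, h) \<in> Tri C \<Longrightarrow> (FM f, FM g, \<theta> (Src C f) \<cdot>\<^bsub>D\<^esub> FM h) \<in> Tri D"
    using F unfolding is_exact_functor_def by blast
  have shift: "FO (ShO C x) \<in> P \<longleftrightarrow> FO x \<in> P" if x: "x \<in> Ob C" for x
  proof -
    \<comment> \<open>The functor commutes with the shift only up to \<open>\<theta>\<close>, so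
      closure of \<open>P\<close> under isomorphism bridges the gap.\<close>
    have "isomorphisms D (FO (ShO C x)) (ShO D (FO x)) \<noteq> {}"
      using \<theta> x unfolding is_natural_isomorphism_def by blast
    then have "FO (ShO C x) \<in> P \<longleftrightarrow> ShO D (FO x) \<in> P"
      by (rule thick_subcategory_iso_iff[OF P D.category_axioms])
    moreover have "FO x \<in> Ob D"
      using \<open>is_functor C D FO FM\<close> x by (auto simp: is_functor_def)
    ultimately show ?thesis
      using P unfolding thick_subcategory_def triangulated_subcategory_def by blast
  qed
  have ShO_closed: "ShO C x \<in> Ob C" if "x \<in> Ob C" for x
    using C.shift_equivalence that unfolding is_equivalence_def is_functor_def by blast
  have cone: "Tgt C g \<in> {x \<in> Ob C. FO x \<in> P}"
    if fgh: "(f, g, h) \<in> Tri C" and "FO (Src C f) \<in> P" "FO (Tgt C f) \<in> P" for f g h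
  proof -
    have f: "f \<in> Hom C (Src C f) (Tgt C f)" and g: "g \<in> Hom C (Tgt C f) (Tgt C g)"
      using C.Tri_candidate fgh unfolding candidate_triangles_def Hom_def by auto
    \<comment> \<open>The third map of the image triangle is twisted by \<open>\<theta>\<close>, but
      the cone condition reads only the ends of the first two maps.\<close>
    have "Src D (FM f) = FO (Src C f)" "Tgt D (FM f) = FO (Tgt C f)" "Tgt D (FM g) = FO (Tgt C g)"
      using hom[OF f] hom[OF g] by (auto simp: Hom_def)
    then have "FO (Tgt C g) \<in> P"
      using thick_subcategoryD(5)[OF P tri[OF fgh]] that(2,3) by simp
    then show ?thesis
      using C.Hom_objects[OF g] by blast
  qed
  have zero: "FO z \<in> P" if "zero_object C z" for z
    using is_additive_functor_zero_object[OF add C.additive_category_axioms D.additive_category_axioms that]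
      P unfolding thick_subcategory_def triangulated_subcategory_def by blast
  have iso: "y \<in> {x \<in> Ob C. FO x \<in> P}" if "FO x \<in> P" "isomorphisms C x y \<noteq> {}" for x y
  proof -
    have "y \<in> Ob C"
      using that(2) C.Hom_objects unfolding isomorphisms_def by blast
    then show ?thesis
      using is_functor_isomorphisms[OF \<open>is_functor C D FO FM\<close> C.category_axioms that(2)]
        thick_subcategory_iso[OF P _ that(1)] by blast
  qed
  have summand: "FO x \<in> P \<and> FO y \<in> P" if "is_biproduct C x y s" "FO s \<in> P" for x y s
    using is_additive_functor_biproduct[OF add C.additive_category_axioms D.additive_category_axioms that(1)]
      that(2) P unfolding thick_subcategory_def by blast
  show ?thesis
  proof (rule thick_subcategoryI)
    show "z \<in> {x \<in> Ob C. FO x \<in> P}" if "zero_object C z" for z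
      using zero that by (simp add: zero_object_def)
    show "y \<in> {x \<in> Ob C. FO x \<in> P}" if "x \<in> {x \<in> Ob C. FO x \<in> P}" "isomorphisms C x y \<noteq> {}" for x y
      using iso[OF _ that(2)] that(1) by simp
    show "ShO C x \<in> {x \<in> Ob C. FO x \<in> P} \<longleftrightarrow> x \<in> {x \<in> Ob C. FO x \<in> P}" if "x \<in> Ob C" for x
      using shift ShO_closed that by simp
    show "Tgt C g \<in> {x \<in> Ob C. FO x \<in> P}" if "(f, g, h) \<in> Tri C"
      "Src C f \<in> {x \<in> Ob C. FO x \<in> P}" "Tgt C f \<in> {x \<in> Ob C. FO x \<in> P}" for f g h
      using cone[OF that(1)] that(2,3) by simp
    show "x \<in> {x \<in> Ob C. FO x \<in> P} \<and> y \<in> {x \<in> Ob C. FO x \<in> P}"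
      if "is_biproduct C x y s" "s \<in> {x \<in> Ob C. FO x \<in> P}" for x y s
      using summand[OF that(1)] that by (simp add: is_biproduct_def)
  qed auto
qed

lemma thick_subcategory_Ob:
  assumes "triangulated_category C" shows "thick_subcategory C (Ob C)"
proof -
  interpret triangulated_category C by fact
  have "ShO C x \<in> Ob C" if "x \<in> Ob C" for x
    using shift_equivalence that unfolding is_equivalence_def is_functor_def by blast
  moreover have "Tgt C g \<in> Ob C" if "(f, g, h) \<in> Tri C" for f g h
    using Tri_candidate that Tgt_closed unfolding candidate_triangles_def by blast
  moreover have "y \<in> Ob C" if "isomorphisms C x y \<noteq> {}" for x y
    using that Hom_objects unfolding isomorphisms_def by blast
  ultimately show ?thesis
    by (intro thick_subcategoryI) (auto simp: zero_object_def is_biproduct_def)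
qed

text \<open>The family is nonempty because the empty intersection is the universe of the type, which
  may exceed \<open>Ob C\<close>.\<close>

lemma thick_subcategory_Inter:
  assumes "\<And>I. I \<in> \<I> \<Longrightarrow> thick_subcategory C I" "\<I> \<noteq> {}"
  shows "thick_subcategory C (\<Inter>\<I>)"
proof -
  obtain I0 where "I0 \<in> \<I>"
    using assms(2) by blast
  then have "\<Inter>\<I> \<subseteq> Ob C"
    using thick_subcategoryD(1)[OF assms(1)] by blast
  then show ?thesis
  proof (rule thick_subcategoryI)
    show "ShO C x \<in> \<Inter>\<I> \<longleftrightarrow> x \<in> \<Inter>\<I>" if "x \<in> Ob C" for x
      using thick_subcategoryD(4)[OF assms(1) that] by simp
    show "Tgt C g \<in> \<Inter>\<I>"
      if "(f, g, h) \<in> Tri C" "Src C f \<in> \<Inter>\<I>" "Tgt C f \<in> \<Inter>\<I>" for f g h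
      using thick_subcategoryD(5)[OF assms(1) that(1)] that(2,3) by simp
    show "y \<in> \<Inter>\<I>" if "x \<in> \<Inter>\<I>" "isomorphisms C x y \<noteq> {}" for x y
      using thick_subcategoryD(3)[OF assms(1) _ that(2)] that(1) by simp
    show "x \<in> \<Inter>\<I> \<and> y \<in> \<Inter>\<I>" if "is_biproduct C x y s" "s \<in> \<Inter>\<I>" for x y s
      using thick_subcategoryD(6)[OF assms(1) that(1)] that(2) by simp
    show "z \<in> \<Inter>\<I>" if "zero_object C z" for z
      using thick_subcategoryD(2)[OF assms(1) that] by simp
  qed
qed

section \<open>Prime ideals and supports\<close>

context monoidal_triangulated_category
begin

section \<open>Quotients of thick ideals and the elementwise form of primeness\<close>

lemma thick_subcategory_quotient_right:
  assumes "thick_subcategory K P" "y \<in> Ob K"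
  shows "thick_subcategory K {a \<in> Ob K. a \<otimes>\<^sub>o y \<in> P}"
  using thick_subcategory_vimage[OF tensor_exact_left] assms triangulated_category_axioms by blast

lemma thick_subcategory_quotient_left:
  assumes "thick_subcategory K P" "x \<in> Ob K"
  shows "thick_subcategory K {b \<in> Ob K. x \<otimes>\<^sub>o b \<in> P}"
  using thick_subcategory_vimage[OF tensor_exact_right] assms triangulated_category_axioms by blast

lemma isomorphisms_tensor_right:
  assumes "a \<in> Ob K" "isomorphisms K x y \<noteq> {}"
  shows "isomorphisms K (a \<otimes>\<^sub>o x) (a \<otimes>\<^sub>o y) \<noteq> {}"
proof -
  have "is_functor K K (\<lambda>y. a \<otimes>\<^sub>o y) (\<lambda>f. Idn K a \<otimes>\<^sub>m f)"
    using tensor_exact_right[OF assms(1)]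
    by (simp add: is_exact_functor_def is_additive_functor_def)
  then show ?thesis
    using category_axioms assms(2) by (rule is_functor_isomorphisms)
qed

lemma thick_tensor_associativity:
  assumes "thick_subcategory K P" "x \<in> Ob K" "y \<in> Ob K" "z \<in> Ob K"
  shows "(x \<otimes>\<^sub>o y) \<otimes>\<^sub>o z \<in> P \<longleftrightarrow> x \<otimes>\<^sub>o (y \<otimes>\<^sub>o z) \<in> P"
  by (rule thick_subcategory_iso_iff[OF assms(1) category_axioms])
    (use Associator_iso assms(2-) in blast)

text \<open>The set is an intersection of inverse images of \<open>P\<close> under the exact
  functors that tensor on the right with \<open>z \<otimes> y\<close>. Quantifying over
  \<open>z\<close> makes it two-sided: a factor on the right of \<open>a\<close> is absorbed into
  \<open>z\<close>, and a factor on the left is handled by \<open>P\<close> itself.\<close>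

lemma thick_tensor_ideal_left_transporter:
  assumes P: "thick_tensor_ideal K P" and y: "y \<in> Ob K"
  shows "thick_tensor_ideal K {a \<in> Ob K. \<forall>z \<in> Ob K. a \<otimes>\<^sub>o (z \<otimes>\<^sub>o y) \<in> P}" (is "thick_tensor_ideal K ?I")
proof -
  have thick: "thick_subcategory K P"
    and closed: "\<And>a w. a \<in> P \<Longrightarrow> w \<in> Ob K \<Longrightarrow> w \<otimes>\<^sub>o a \<in> P"
    using P by (auto simp: thick_tensor_ideal_def)
  have "thick_subcategory K (\<Inter>z \<in> Ob K. {a \<in> Ob K. a \<otimes>\<^sub>o (z \<otimes>\<^sub>o y) \<in> P})"
    by (rule thick_subcategory_Inter)
      (use thick_subcategory_quotient_right[OF thick] TenO_closed y TUnit_closed in auto)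
  \<comment> \<open>The unit object witnesses that the index set is nonempty, which keeps the
    intersection inside \<open>Ob K\<close>.\<close>
  also have "(\<Inter>z \<in> Ob K. {a \<in> Ob K. a \<otimes>\<^sub>o (z \<otimes>\<^sub>o y) \<in> P}) = ?I"
    using TUnit_closed by auto
  finally have "thick_subcategory K ?I" .
  moreover have "a \<otimes>\<^sub>o w \<in> ?I" if "a \<in> ?I" "w \<in> Ob K" for a w
  proof -
    have "(a \<otimes>\<^sub>o w) \<otimes>\<^sub>o (z \<otimes>\<^sub>o y) \<in> P" if z: "z \<in> Ob K" for z
    proof -
      \<comment> \<open>The membership of \<open>a\<close> is used at \<open>w \<otimes> z\<close>;
        what follows moves the brackets, first inside the right factor and then outside.\<close>
      have "a \<otimes>\<^sub>o ((w \<otimes>\<^sub>o z) \<otimes>\<^sub>o y) \<in> P"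
        using \<open>a \<in> ?I\<close> \<open>w \<in> Ob K\<close> z TenO_closed by blast
      moreover have "isomorphisms K (a \<otimes>\<^sub>o ((w \<otimes>\<^sub>o z) \<otimes>\<^sub>o y)) (a \<otimes>\<^sub>o (w \<otimes>\<^sub>o (z \<otimes>\<^sub>o y))) \<noteq> {}"
      proof (rule isomorphisms_tensor_right)
        show "a \<in> Ob K"
          using \<open>a \<in> ?I\<close> by simp
        show "isomorphisms K ((w \<otimes>\<^sub>o z) \<otimes>\<^sub>o y) (w \<otimes>\<^sub>o (z \<otimes>\<^sub>o y)) \<noteq> {}"
          using Associator_iso \<open>w \<in> Ob K\<close> z y by blast
      qed
      ultimately have "a \<otimes>\<^sub>o (w \<otimes>\<^sub>o (z \<otimes>\<^sub>o y)) \<in> P"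
        using thick_subcategory_iso[OF thick] by blast
      then show ?thesis
        using thick_tensor_associativity[OF thick] \<open>a \<in> ?I\<close> \<open>w \<in> Ob K\<close> z y TenO_closed by blast
    qed
    then show ?thesis
      using that TenO_closed by blast
  qed
  moreover have "w \<otimes>\<^sub>o a \<in> ?I" if "a \<in> ?I" "w \<in> Ob K" for a w
    using that closed thick_tensor_associativity[OF thick] TenO_closed y by simp
  ultimately show ?thesis
    unfolding thick_tensor_ideal_def by blast
qed

text \<open>A factor to the right of \<open>b\<close> is absorbed by \<open>P\<close>, and a factor
  to its left is moved onto \<open>a\<close> and absorbed by \<open>I\<close>. Thus the ideal
  property of \<open>I\<close> supplies the second side.\<close>

lemma thick_tensor_ideal_right_quotient:
  assumes P: "thick_tensor_ideal K P" and I: "thick_tensor_ideal K I"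
  shows "thick_tensor_ideal K {b \<in> Ob K. \<forall>a \<in> I. a \<otimes>\<^sub>o b \<in> P}" (is "thick_tensor_ideal K ?J")
proof -
  have thick: "thick_subcategory K P"
    and closed: "\<And>a w. a \<in> P \<Longrightarrow> w \<in> Ob K \<Longrightarrow> a \<otimes>\<^sub>o w \<in> P"
    using P by (auto simp: thick_tensor_ideal_def)
  have I_Ob: "I \<subseteq> Ob K" and I_closed: "\<And>a w. a \<in> I \<Longrightarrow> w \<in> Ob K \<Longrightarrow> a \<otimes>\<^sub>o w \<in> I"
    using I by (auto simp: thick_tensor_ideal_def thick_subcategory_def triangulated_subcategory_def)
  \<comment> \<open>Inserting \<open>Ob K\<close> makes the family visibly nonempty and does not
    change the intersection inside \<open>Ob K\<close>.\<close>
  have "thick_subcategory K (\<Inter>(insert (Ob K) ((\<lambda>a. {b \<in> Ob K. a \<otimes>\<^sub>o b \<in> P}) ` I)))"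
    by (rule thick_subcategory_Inter)
      (use thick_subcategory_quotient_left[OF thick] I_Ob
         thick_subcategory_Ob[OF triangulated_category_axioms] in auto)
  also have "\<Inter>(insert (Ob K) ((\<lambda>a. {b \<in> Ob K. a \<otimes>\<^sub>o b \<in> P}) ` I)) = ?J"
    by auto
  finally have "thick_subcategory K ?J" .
  moreover have "b \<otimes>\<^sub>o w \<in> ?J" if "b \<in> ?J" "w \<in> Ob K" for b w
  proof -
    have "a \<otimes>\<^sub>o (b \<otimes>\<^sub>o w) \<in> P" if "a \<in> I" for a
      using closed[of "a \<otimes>\<^sub>o b" w] thick_tensor_associativity[OF thick, of a b w]
        \<open>b \<in> ?J\<close> \<open>w \<in> Ob K\<close> \<open>a \<in> I\<close> I_Ob by auto
    then show ?thesis
      using that TenO_closed by simp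
  qed
  moreover have "w \<otimes>\<^sub>o b \<in> ?J" if "b \<in> ?J" "w \<in> Ob K" for b w
  proof -
    have "a \<otimes>\<^sub>o (w \<otimes>\<^sub>o b) \<in> P" if "a \<in> I" for a
      using I_closed[of a w] thick_tensor_associativity[OF thick, of a w b]
        \<open>b \<in> ?J\<close> \<open>w \<in> Ob K\<close> \<open>a \<in> I\<close> I_Ob by auto
    then show ?thesis
      using that TenO_closed by simp
  qed
  ultimately show ?thesis
    unfolding thick_tensor_ideal_def by blast
qed

text \<open>This is the analogue of the criterion \<open>x R y \<subseteq> P\<close> for prime
  ideals of a noncommutative ring \<open>R\<close>.\<close>

lemma prime_tensor_ideal_elementwise:
  assumes P: "prime_tensor_ideal K P" and x: "x \<in> Ob K" and y: "y \<in> Ob K"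
    and xzy: "\<And>z. z \<in> Ob K \<Longrightarrow> x \<otimes>\<^sub>o (z \<otimes>\<^sub>o y) \<in> P"
  shows "x \<in> P \<or> y \<in> P"
proof -
  define I where "I = {a \<in> Ob K. \<forall>z \<in> Ob K. a \<otimes>\<^sub>o (z \<otimes>\<^sub>o y) \<in> P}"
  define J where "J = {b \<in> Ob K. \<forall>a \<in> I. a \<otimes>\<^sub>o b \<in> P}"
  have P': "thick_tensor_ideal K P"
    using P by (simp add: prime_tensor_ideal_def)
  then have thick: "thick_subcategory K P"
    by (simp add: thick_tensor_ideal_def)
  have I: "thick_tensor_ideal K I"
    unfolding I_def by (rule thick_tensor_ideal_left_transporter[OF P' y])
  then have J: "thick_tensor_ideal K J"
    unfolding J_def by (rule thick_tensor_ideal_right_quotient[OF P'])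
  have "{a \<otimes>\<^sub>o b |a b. a \<in> I \<and> b \<in> J} \<subseteq> P"
    by (auto simp: J_def)
  then have "I \<subseteq> P \<or> J \<subseteq> P"
    using P I J unfolding prime_tensor_ideal_def by blast
  moreover have "x \<in> I"
    using x xzy by (simp add: I_def)
  \<comment> \<open>The defining condition of \<open>I\<close> is specialised to the unit object,
    which the left unitor then removes.\<close>
  moreover have "a \<otimes>\<^sub>o y \<in> P" if "a \<in> I" for a
  proof -
    have a: "a \<in> Ob K" "a \<otimes>\<^sub>o (TUnit K \<otimes>\<^sub>o y) \<in> P"
      using that TUnit_closed by (auto simp: I_def)
    have "isomorphisms K (a \<otimes>\<^sub>o (TUnit K \<otimes>\<^sub>o y)) (a \<otimes>\<^sub>o y) \<noteq> {}"
    proof (rule isomorphisms_tensor_right[OF a(1)])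
      show "isomorphisms K (TUnit K \<otimes>\<^sub>o y) y \<noteq> {}"
        using LUnitor_natural y unfolding is_natural_isomorphism_def by blast
    qed
    then show ?thesis
      using thick_subcategory_iso[OF thick] a(2) by blast
  qed
  then have "y \<in> J"
    using y by (simp add: J_def)
  ultimately show ?thesis
    by blast
qed

section \<open>The topology generated by the supports\<close>

lemma supp_Int:
  assumes x: "x \<in> Ob K" and y: "y \<in> Ob K"
  shows "supp K x \<inter> supp K y = (\<Union>z \<in> Ob K. supp K (x \<otimes>\<^sub>o (z \<otimes>\<^sub>o y)))"
proof -
  have "x \<notin> P \<and> y \<notin> P \<longleftrightarrow> (\<exists>z \<in> Ob K. x \<otimes>\<^sub>o (z \<otimes>\<^sub>o y) \<notin> P)" if P: "P \<in> Spc K" for P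
  proof -
    have prime: "prime_tensor_ideal K P"
      using P by (simp add: Spc_def)
    then have "thick_tensor_ideal K P"
      by (simp add: prime_tensor_ideal_def)
    then have "x \<otimes>\<^sub>o (z \<otimes>\<^sub>o y) \<in> P" if "z \<in> Ob K" "x \<in> P \<or> y \<in> P" for z
      using that x y TenO_closed by (auto simp: thick_tensor_ideal_def)
    then show ?thesis
      using prime_tensor_ideal_elementwise[OF prime x y] by meson
  qed
  then show ?thesis
    unfolding supp_def by blast
qed

text \<open>Since \<open>topology\<close> is total, its argument must first be shown to be a
  topology. By \<open>istopology_base_eq\<close> it suffices that the intersection of two supports
  is a union of supports.\<close>

lemma openin_Spc_nu: "openin (Spc_nu K) = arbitrary union_of (\<lambda>U. \<exists>x \<in> Ob K. U = supp K x)"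
proof -
  have "(arbitrary union_of (\<lambda>U. \<exists>x \<in> Ob K. U = supp K x)) (supp K x \<inter> supp K y)"
    if "x \<in> Ob K" "y \<in> Ob K" for x y
    unfolding supp_Int[OF that]
    by (rule arbitrary_union_of_Union)
      (use that TenO_closed in \<open>auto intro!: arbitrary_union_of_inc\<close>)
  then have "istopology (arbitrary union_of (\<lambda>U. \<exists>x \<in> Ob K. U = supp K x))"
    unfolding istopology_base_eq by blast
  then show ?thesis
    unfolding Spc_nu_def by (rule topology_inverse')
qed

lemma openin_Spc_nu_iff: "openin (Spc_nu K) U \<longleftrightarrow> (\<exists>A \<subseteq> Ob K. U = (\<Union>x \<in> A. supp K x))"
proof
  assume "openin (Spc_nu K) U"
  then obtain \<U> where \<U>: "\<forall>V \<in> \<U>. \<exists>x \<in> Ob K. V = supp K x" "U = \<Union>\<U>"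
    by (auto simp: openin_Spc_nu union_of_def)
  \<comment> \<open>A family of supports is re-indexed by all objects whose support belongs to it,
    which avoids choosing representatives.\<close>
  then have "U = (\<Union>x \<in> {x \<in> Ob K. supp K x \<in> \<U>}. supp K x)"
    by fastforce
  then show "\<exists>A \<subseteq> Ob K. U = (\<Union>x \<in> A. supp K x)"
    by blast
next
  assume "\<exists>A \<subseteq> Ob K. U = (\<Union>x \<in> A. supp K x)"
  then obtain A where A: "A \<subseteq> Ob K" "U = (\<Union>x \<in> A. supp K x)"
    by blast
  have "openin (Spc_nu K) (supp K x)" if "x \<in> A" for x
    unfolding openin_Spc_nu by (rule arbitrary_union_of_inc) (use that A(1) in blast)
  then show "openin (Spc_nu K) U"
    unfolding A(2) by (intro openin_Union) auto
qed

text \<open>Strictness provides an object outside each prime, so the supports cover the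
  spectrum.\<close>

lemma Spc_subset_Ob: "P \<in> Spc K \<Longrightarrow> P \<subset> Ob K"
  using thick_subcategoryD(1)[of K P]
  by (auto simp: Spc_def prime_tensor_ideal_def thick_tensor_ideal_def)

lemma topspace_Spc_nu: "topspace (Spc_nu K) = Spc K"
proof
  show "topspace (Spc_nu K) \<subseteq> Spc K"
    unfolding topspace_def openin_Spc_nu_iff supp_def by blast
  have "openin (Spc_nu K) (\<Union>x \<in> Ob K. supp K x)"
    unfolding openin_Spc_nu_iff by blast
  moreover have "(\<Union>x \<in> Ob K. supp K x) = Spc K"
    using Spc_subset_Ob unfolding supp_def by blast
  ultimately show "Spc K \<subseteq> topspace (Spc_nu K)"
    using openin_subset by metis
qed

section \<open>Semiprime ideals and open sets\<close>

lemma UN_supp_eq: "(\<Union>x \<in> A. supp K x) = {P \<in> Spc K. \<not> A \<subseteq> P}"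
  unfolding supp_def by blast

text \<open>Write \<open>J\<close> as an intersection of primes. Each of them contains
  \<open>J\<close>, so it lies outside the union for \<open>J\<close>, hence outside the union for
  \<open>I\<close>, which means that it contains \<open>I\<close>.\<close>

lemma UN_supp_subset_iff:
  assumes "semiprime_tensor_ideal K I" "semiprime_tensor_ideal K J"
  shows "(\<Union>x \<in> I. supp K x) \<subseteq> (\<Union>x \<in> J. supp K x) \<longleftrightarrow> I \<subseteq> J"
proof
  assume le: "(\<Union>x \<in> I. supp K x) \<subseteq> (\<Union>x \<in> J. supp K x)"
  obtain S where S: "S \<subseteq> Spc K" "J = Ob K \<inter> \<Inter>S"
    using assms(2) by (auto simp: semiprime_tensor_ideal_def)
  have "I \<subseteq> P" if "P \<in> S" for P
  proof -
    have "P \<in> Spc K" "J \<subseteq> P"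
      using that S by auto
    then show ?thesis
      using le unfolding UN_supp_eq by blast
  qed
  \<comment> \<open>This handles the factor \<open>Ob K\<close> of \<open>J\<close>, which is all
    that remains when \<open>S\<close> is empty.\<close>
  moreover have "I \<subseteq> Ob K"
    using assms(1) by (auto simp: semiprime_tensor_ideal_def)
  ultimately show "I \<subseteq> J"
    unfolding S(2) by blast
qed blast

lemma bij_betw_UN_supp:
  "bij_betw (\<lambda>I. \<Union>x \<in> I. supp K x) {I. semiprime_tensor_ideal K I} {U. openin (Spc_nu K) U}"
proof (rule bij_betw_imageI)
  show "inj_on (\<lambda>I. \<Union>x \<in> I. supp K x) {I. semiprime_tensor_ideal K I}"
    by (rule inj_onI) (metis UN_supp_subset_iff mem_Collect_eq order_refl subset_antisym)
  show "(\<lambda>I. \<Union>x \<in> I. supp K x) ` {I. semiprime_tensor_ideal K I} = {U. openin (Spc_nu K) U}"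
  proof (intro equalityI subsetI)
    fix U assume "U \<in> {U. openin (Spc_nu K) U}"
    then obtain A where A: "A \<subseteq> Ob K" "U = (\<Union>x \<in> A. supp K x)"
      by (auto simp: openin_Spc_nu_iff)
    \<comment> \<open>The smallest semiprime ideal containing \<open>A\<close>: the primes
      containing it are exactly those containing \<open>A\<close>, so both give the same union of
      supports.\<close>
    let ?I = "Ob K \<inter> \<Inter>{P \<in> Spc K. A \<subseteq> P}"
    have "semiprime_tensor_ideal K ?I"
      unfolding semiprime_tensor_ideal_def by blast
    moreover have "(\<Union>x \<in> ?I. supp K x) = U"
      unfolding A(2) UN_supp_eq using A(1) by blast
    ultimately show "U \<in> (\<lambda>I. \<Union>x \<in> I. supp K x) ` {I. semiprime_tensor_ideal K I}"
      by blast
  qed (auto simp: openin_Spc_nu_iff semiprime_tensor_ideal_def)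
qed

end

theorem theoremA:
  fixes K :: "('o, 'm) mt_category"
  assumes "monoidal_triangulated_category K"
  shows "topspace (Spc_nu K) = Spc K \<and>
    openin (Spc_nu K) = arbitrary union_of (\<lambda>U. \<exists>x \<in> Ob K. U = supp K x) \<and>
    lattice_isomorphism (semiprime_lattice K) (open_lattice (Spc_nu K)) (\<lambda>I. \<Union>x \<in> I. supp K x) \<and>
    frame_isomorphism (semiprime_lattice K) (open_lattice (Spc_nu K)) (\<lambda>I. \<Union>x \<in> I. supp K x)"
proof -
  interpret monoidal_triangulated_category K by fact
  have po: "partial_order (semiprime_lattice K)"
    unfolding semiprime_lattice_def by (rule partial_order_inclusion)
  have bij: "bij_betw (\<lambda>I. \<Union>x \<in> I. supp K x)
      (carrier (semiprime_lattice K)) (carrier (open_lattice (Spc_nu K)))"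
    using bij_betw_UN_supp by (simp add: semiprime_lattice_def open_lattice_def)
  have le: "(\<Union>x \<in> I. supp K x) \<sqsubseteq>\<^bsub>open_lattice (Spc_nu K)\<^esub> (\<Union>x \<in> J. supp K x) \<longleftrightarrow>
      I \<sqsubseteq>\<^bsub>semiprime_lattice K\<^esub> J"
    if "I \<in> carrier (semiprime_lattice K)" "J \<in> carrier (semiprime_lattice K)" for I J
    using that UN_supp_subset_iff[of I J] by (simp add: semiprime_lattice_def open_lattice_def)
  \<comment> \<open>The first two conjuncts certify that \<open>Spc_nu K\<close> has the intended
    points and open sets despite the totality of \<open>topology\<close>.\<close>
  show ?thesis
    using topspace_Spc_nu openin_Spc_nu order_iso_frame_isomorphism[OF po frame_open_lattice bij le]
    by blast
qed

end
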